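(* Let $f:\mathbb{R}^d\to\mathbb{R}$ be a differentiable convex function with unique minimizer $x^\star$, satisfying for some $\alpha>0$ the $\alpha$-quadratic growth condition $f(x)\ge f(x^\star)+\frac{\alpha}{2}\|x-x^\star\|^2$ for all $x\in\mathbb{R}^d$. Let $\varepsilon>0$ and $X_0\in\mathbb{R}^d$, and set $$K=\left\lceil4\log\frac{f(X_0)-f(x^\star)}{\varepsilon}\right\rceil,\qquad T_k=\frac{5}{2\sqrt\alpha}\quad\text{for all }k\in\{1,\dots,K\},$$ where $K$ is a positive integer (as the algorithm requires). Then the output $X_K$ of the algorithm HFA run from $X_0$ for $K$ iterations with parameter $\lambda=0$ and integration times $T_1,\dots,T_K$ satisfies $f(X_K)-f(x^\star)\le\varepsilon$, and the total integration time is $$\sum_{k=1}^KT_k=\frac{5}{2\sqrt\alpha}\left\lceil4\log\frac{f(X_0)-f(x^\star)}{\varepsilon}\right\rceil.$$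
   Context: The Hamiltonian flow of $f$ is the system $\dot X_t=Y_t$, $\dot Y_t=-\nabla f(X_t)$ on $\mathbb{R}^d\times\mathbb{R}^d$. Standing assumption: for every initial condition it admits a unique solution on $[0,\infty)$. $\log$ is the natural logarithm. Algorithm HFA (Hamiltonian Flow for optimization with Averaging). Input: $X_0\in\mathbb{R}^d$, number of iterations $K\in\mathbb{N}$, parameter $\lambda\ge0$, integration times $T_1,\dots,T_K>0$. For $k=1,\dots,K$: let $(X^{(k)}_t,Y^{(k)}_t)_{t\in[0,T_k]}$ be the Hamiltonian flow with initial condition $(X^{(k)}_0,Y^{(k)}_0)=(X_{k-1},\mathbf{0})$; compute $X^{\mathrm{avg}}(X_{k-1};T_k)=\frac{2}{T_k^2}\int_0^{T_k}(T_k-t)X^{(k)}_t\,\mathrm{d}t$; set $X_k=\frac{1}{\lambda+1}X^{\mathrm{avg}}(X_{k-1};T_k)+\frac{\lambda}{\lambda+1}X^{(k)}_{T_k}$. Output: $X_K$. *)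

theory Defs
  imports "HOL-Analysis.Analysis"
begin

definition unique_minimizer :: "('a \<Rightarrow> real) \<Rightarrow> 'a \<Rightarrow> bool" where
  "unique_minimizer f x \<longleftrightarrow>
     (\<forall>y. f x \<le> f y) \<and> (\<forall>z. (\<forall>y. f z \<le> f y) \<longrightarrow> z = x)"

definition quadratic_growth :: "real \<Rightarrow> ('a::real_normed_vector \<Rightarrow> real) \<Rightarrow> 'a \<Rightarrow> bool" where
  "quadratic_growth \<alpha> f xmin \<longleftrightarrow> (\<forall>x. f x \<ge> f xmin + \<alpha> / 2 * (norm (x - xmin))\<^sup>2)"

definition grad :: "('a::real_inner \<Rightarrow> real) \<Rightarrow> 'a \<Rightarrow> 'a" where
  "grad f x = (THE D. GDERIV f x :> D)"

text \<open>Trajectories are total functions on the reals of which only the values at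
  nonnegative times are meaningful; derivatives at time 0 are one-sided.\<close>

definition hamiltonian_solution ::
    "('a::real_inner \<Rightarrow> real) \<Rightarrow> 'a \<Rightarrow> 'a \<Rightarrow> (real \<Rightarrow> 'a) \<Rightarrow> (real \<Rightarrow> 'a) \<Rightarrow> bool" where
  "hamiltonian_solution f x0 y0 X Y \<longleftrightarrow>
     X 0 = x0 \<and> Y 0 = y0 \<and>
     (\<forall>t\<ge>0. (X has_vector_derivative Y t) (at t within {0..}) \<and>
            (Y has_vector_derivative - grad f (X t)) (at t within {0..}))"

definition hamiltonian_well_posed :: "('a::real_inner \<Rightarrow> real) \<Rightarrow> bool" where
  "hamiltonian_well_posed f \<longleftrightarrow>
     (\<forall>x0 y0. (\<exists>X Y. hamiltonian_solution f x0 y0 X Y) \<and>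
        (\<forall>X Y X' Y'. hamiltonian_solution f x0 y0 X Y \<longrightarrow> hamiltonian_solution f x0 y0 X' Y' \<longrightarrow>
           (\<forall>t\<ge>0. X t = X' t \<and> Y t = Y' t)))"

text \<open>The position at time \<open>t\<close>. Since solutions are unique only at nonnegative times,
  the description picks out the value there rather than the trajectory.\<close>

definition flow_position :: "('a::real_inner \<Rightarrow> real) \<Rightarrow> 'a \<Rightarrow> 'a \<Rightarrow> real \<Rightarrow> 'a" where
  "flow_position f x0 y0 t = (THE p. \<exists>X Y. hamiltonian_solution f x0 y0 X Y \<and> p = X t)"

definition flow_average :: "('a::euclidean_space \<Rightarrow> real) \<Rightarrow> 'a \<Rightarrow> real \<Rightarrow> 'a" where
  "flow_average f x T =
     (2 / T\<^sup>2) *\<^sub>R integral {0..T} (\<lambda>t. (T - t) *\<^sub>R flow_position f x 0 t)"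

text \<open>\<open>HFA f lam T x0 k\<close> is the \<open>k\<close>-th iterate; the integration times are indexed from 1.\<close>

primrec HFA ::
    "('a::euclidean_space \<Rightarrow> real) \<Rightarrow> real \<Rightarrow> (nat \<Rightarrow> real) \<Rightarrow> 'a \<Rightarrow> nat \<Rightarrow> 'a" where
  "HFA f lam T x0 0 = x0"
| "HFA f lam T x0 (Suc k) =
     (1 / (lam + 1)) *\<^sub>R flow_average f (HFA f lam T x0 k) (T (Suc k)) +
     (lam / (lam + 1)) *\<^sub>R flow_position f (HFA f lam T x0 k) 0 (T (Suc k))"

end

theory Submission
  imports Defs
begin

text \<open>One iteration contracts the optimality gap by the factor \<open>58/75 \<le> exp (- 1/4)\<close>, so
  \<open>K \<ge> 4 ln (gap / \<epsilon>)\<close> iterations suffice.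

  The contraction comes from a virial computation along the flow \<open>X\<close> started at rest from \<open>x\<close>.
  Write \<open>D p = f p - f z\<close>. The function
  \<open>G t = (T - t) \<langle>Y t, X t - z\<rangle> + \<parallel>X t - z\<parallel>\<^sup>2 / 2\<close> satisfies
  \<open>G' t = (T - t) (\<parallel>Y t\<parallel>\<^sup>2 - \<langle>\<nabla>f (X t), X t - z\<rangle>)\<close>. Conservation of energy turns the
  kinetic term into \<open>2 (D x - D (X t))\<close>, and convexity bounds the other one by \<open>- D (X t)\<close>; hence
  \<open>G' t \<le> (T - t) (2 D x - 3 D (X t))\<close>. Integrate: the first summand of \<open>G\<close> vanishes
  at both ends, since the flow starts at rest and the weight is zero at time \<open>T\<close>, so
  \<open>G T - G 0 \<ge> - \<parallel>x - z\<parallel>\<^sup>2 / 2\<close>. As \<open>T - t\<close> is also the weight that defines the averaged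
  point, Jensen's inequality gives
  \<open>3 D (average) \<le> 2 D x + \<parallel>x - z\<parallel>\<^sup>2 / T\<^sup>2\<close> (lemma \<open>flow_average_gap\<close>). The
  distance is controlled by quadratic growth when \<open>z\<close> is the minimizer: \<open>\<parallel>x - z\<parallel>\<^sup>2 \<le> 2 D x / \<alpha>\<close>.
  With \<open>T\<^sup>2 = 25 / (4 \<alpha>)\<close> the resulting factor is \<open>(2 + 8/25) / 3 = 58/75\<close>.\<close>

lemma GDERIV_grad:
  fixes f :: "'a::euclidean_space \<Rightarrow> real"
  assumes "f differentiable (at x)"
  shows "GDERIV f x :> grad f x"
proof -
  obtain D where D: "(f has_derivative D) (at x)"
    using assms by (auto simp: differentiable_def)
  have "D = (\<lambda>h. h \<bullet> adjoint D 1)"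
    using adjoint_works[OF has_derivative_linear[OF D], of _ 1] by (simp add: fun_eq_iff)
  from arg_cong[OF this, of "\<lambda>d. (f has_derivative d) (at x)"] D
  have ex: "GDERIV f x :> adjoint D 1"
    unfolding gderiv_def by (rule iffD1)
  have "a = adjoint D 1" if "GDERIV f x :> a" for a
  proof -
    have "(\<lambda>h. h \<bullet> a) = (\<lambda>h. h \<bullet> adjoint D 1)"
      using that ex unfolding gderiv_def by (rule has_derivative_unique)
    then show ?thesis
      by (simp add: fun_eq_iff vector_eq_ldot)
  qed
  with ex show ?thesis
    unfolding grad_def by (rule theI)
qed

lemma convex_on_above_gradient_plane:
  fixes f :: "'a::euclidean_space \<Rightarrow> real"
  assumes "convex_on UNIV f" "f differentiable (at x)"
  shows "f x + grad f x \<bullet> (y - x) \<le> f y"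
proof -
  define \<phi> where "\<phi> s = f (x + s *\<^sub>R (y - x))" for s :: real
  have "convex_on UNIV \<phi>"
  proof
    fix t a b :: real
    assume "0 < t" "t < 1"
    then have "f ((1 - t) *\<^sub>R (x + a *\<^sub>R (y - x)) + t *\<^sub>R (x + b *\<^sub>R (y - x)))
      \<le> (1 - t) * \<phi> a + t * \<phi> b"
      unfolding \<phi>_def by (intro convex_onD[OF assms(1)]) auto
    moreover have "(1 - t) *\<^sub>R (x + a *\<^sub>R (y - x)) + t *\<^sub>R (x + b *\<^sub>R (y - x))
      = x + ((1 - t) *\<^sub>R a + t *\<^sub>R b) *\<^sub>R (y - x)"
      by (simp add: algebra_simps)
    ultimately show "\<phi> ((1 - t) *\<^sub>R a + t *\<^sub>R b) \<le> (1 - t) * \<phi> a + t * \<phi> b"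
      by (simp add: \<phi>_def)
  qed auto
  moreover have "(\<phi> has_field_derivative grad f x \<bullet> (y - x)) (at 0)"
  proof -
    have f': "(f has_derivative (\<lambda>h. h \<bullet> grad f x)) (at (x + 0 *\<^sub>R (y - x)))"
      using GDERIV_grad[OF assms(2)] by (simp add: gderiv_def)
    have "((\<lambda>s. x + s *\<^sub>R (y - x)) has_derivative (\<lambda>s. s *\<^sub>R (y - x))) (at 0)"
      by (auto intro!: derivative_eq_intros)
    from has_derivative_compose[OF this f'] show ?thesis
      by (simp add: \<phi>_def[abs_def] has_field_derivative_def inner_commute mult.commute[of _ "_ \<bullet> _"])
  qed
  ultimately have "(grad f x \<bullet> (y - x)) * (1 - 0) \<le> \<phi> 1 - \<phi> 0"
    by (intro convex_on_imp_above_tangent[where A = UNIV]) auto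
  then show ?thesis
    by (simp add: \<phi>_def)
qed

lemma hamiltonian_energy_conserved:
  fixes f :: "'a::euclidean_space \<Rightarrow> real"
  assumes f: "\<And>x. f differentiable (at x)" and sol: "hamiltonian_solution f x0 y0 X Y"
    and "0 \<le> t"
  shows "f (X t) + (norm (Y t))\<^sup>2 / 2 = f x0 + (norm y0)\<^sup>2 / 2"
proof -
  define H where "H t = f (X t) + (Y t \<bullet> Y t) / 2" for t
  have "(H has_derivative (\<lambda>_. 0)) (at s within {0..})" if "s \<in> {0..}" for s
  proof -
    have X': "(X has_derivative (\<lambda>h. h *\<^sub>R Y s)) (at s within {0..})"
      and Y': "(Y has_derivative (\<lambda>h. h *\<^sub>R - grad f (X s))) (at s within {0..})"
      using sol that by (auto simp: hamiltonian_solution_def has_vector_derivative_def)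
    have "(f has_derivative (\<lambda>h. h \<bullet> grad f (X s))) (at (X s))"
      using GDERIV_grad[OF f] by (simp add: gderiv_def)
    from has_derivative_compose[OF X' this]
    have "((\<lambda>s. f (X s)) has_derivative (\<lambda>h. (h *\<^sub>R Y s) \<bullet> grad f (X s))) (at s within {0..})" .
    then show ?thesis
      unfolding H_def
      by (auto intro!: derivative_eq_intros Y' simp: inner_commute)
  qed
  then obtain c where "\<And>s. s \<in> {0..} \<Longrightarrow> H s = c"
    using has_derivative_zero_constant[of "{0..}" H] by auto
  then have "H t = H 0"
    using \<open>0 \<le> t\<close> by simp
  then show ?thesis
    using sol by (simp add: H_def hamiltonian_solution_def dot_square_norm)
qed

lemma flow_position_eq:
  assumes "hamiltonian_well_posed f" "hamiltonian_solution f x0 y0 X Y" "0 \<le> t"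
  shows "flow_position f x0 y0 t = X t"
  unfolding flow_position_def
  using assms unfolding hamiltonian_well_posed_def by (intro the_equality) blast+

lemma has_integral_linear_weight:
  fixes T :: real
  assumes "0 \<le> T"
  shows "((\<lambda>t. T - t) has_integral T\<^sup>2 / 2) {0..T}"
proof -
  have "((\<lambda>t. T - t) has_integral (T * T - T\<^sup>2 / 2) - (T * 0 - 0\<^sup>2 / 2)) {0..T}"
    using assms
    by (intro fundamental_theorem_of_calculus)
       (auto intro!: derivative_eq_intros simp flip: has_real_derivative_iff_has_vector_derivative)
  then show ?thesis
    by (simp add: power2_eq_square)
qed

text \<open>Jensen's inequality for the weight \<open>T - t\<close> enters in the form of
  the supporting hyperplane of \<open>f\<close> at the averaged point: its linear part integrates to zero, so
  the values \<open>f (X t)\<close> themselves never have to be integrated.\<close>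

lemma flow_average_gap:
  fixes f :: "'a::euclidean_space \<Rightarrow> real"
  assumes f: "\<And>x. f differentiable (at x)" and cvx: "convex_on UNIV f"
    and wp: "hamiltonian_well_posed f" and T: "0 < T"
  shows "3 * (f (flow_average f x T) - f z) \<le> 2 * (f x - f z) + (norm (x - z))\<^sup>2 / T\<^sup>2"
proof -
  obtain X Y where sol: "hamiltonian_solution f x 0 X Y"
    using wp unfolding hamiltonian_well_posed_def by blast
  have X0: "X 0 = x" and Y0: "Y 0 = 0"
    using sol by (auto simp: hamiltonian_solution_def)
  have X': "(X has_derivative (\<lambda>h. h *\<^sub>R Y t)) (at t within {0..T})"
    and Y': "(Y has_derivative (\<lambda>h. h *\<^sub>R - grad f (X t))) (at t within {0..T})"
    if "t \<in> {0..T}" for t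
    using sol that
    by (auto simp: hamiltonian_solution_def has_vector_derivative_def intro: has_derivative_subset)
  define a where "a = flow_average f x T"
  define g where "g = grad f a"

  have "continuous_on {0..T} X"
    using X' by (intro has_derivative_continuous_on)
  then have "((\<lambda>t. (T - t) *\<^sub>R X t) has_integral integral {0..T} (\<lambda>t. (T - t) *\<^sub>R X t)) {0..T}"
    by (intro integrable_integral integrable_continuous_real continuous_intros)
  moreover have "integral {0..T} (\<lambda>t. (T - t) *\<^sub>R X t) = (T\<^sup>2 / 2) *\<^sub>R a"
  proof -
    have "integral {0..T} (\<lambda>t. (T - t) *\<^sub>R flow_position f x 0 t)
        = integral {0..T} (\<lambda>t. (T - t) *\<^sub>R X t)"
      by (intro integral_cong) (simp add: flow_position_eq[OF wp sol])
    then show ?thesis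
      using T by (simp add: a_def flow_average_def)
  qed
  ultimately have "((\<lambda>t. (T - t) *\<^sub>R X t) has_integral (T\<^sup>2 / 2) *\<^sub>R a) {0..T}"
    by simp
  from has_integral_linear[OF this bounded_linear_inner_right[of g]]
  have X_int: "((\<lambda>t. (T - t) * (g \<bullet> X t)) has_integral T\<^sup>2 / 2 * (g \<bullet> a)) {0..T}"
    by (simp add: o_def)
  define c where "c = 2 * (f x - f z) - 3 * (f a - f z)"
  have "((\<lambda>t. (T - t) * (c + 3 * (g \<bullet> a)) - 3 * ((T - t) * (g \<bullet> X t))) has_integral
      T\<^sup>2 / 2 * (c + 3 * (g \<bullet> a)) - 3 * (T\<^sup>2 / 2 * (g \<bullet> a))) {0..T}"
    using T by (intro has_integral_diff has_integral_mult_left has_integral_mult_right X_int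
        has_integral_linear_weight) auto
  moreover have "T\<^sup>2 / 2 * (c + 3 * (g \<bullet> a)) - 3 * (T\<^sup>2 / 2 * (g \<bullet> a)) = T\<^sup>2 / 2 * c"
    by (simp add: field_simps)
  moreover have "(\<lambda>t. (T - t) * (c + 3 * (g \<bullet> a)) - 3 * ((T - t) * (g \<bullet> X t)))
      = (\<lambda>t. (T - t) * (c - 3 * (g \<bullet> (X t - a))))"
    by (simp add: algebra_simps inner_diff_right)
  ultimately have bound_int:
    "((\<lambda>t. (T - t) * (c - 3 * (g \<bullet> (X t - a)))) has_integral T\<^sup>2 / 2 * c) {0..T}"
    by (simp only:)

  define G where "G t = (T - t) * (Y t \<bullet> (X t - z)) + ((X t - z) \<bullet> (X t - z)) / 2" for t
  define G' where "G' t = (T - t) * (Y t \<bullet> Y t - grad f (X t) \<bullet> (X t - z))" for t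
  have "(G has_vector_derivative G' t) (at t within {0..T})" if "t \<in> {0..T}" for t
    unfolding G_def G'_def has_vector_derivative_def
    by (auto intro!: derivative_eq_intros X'[OF that] Y'[OF that]
        simp: field_simps inner_diff_right inner_diff_left inner_add_left inner_add_right
          inner_commute fun_eq_iff)
  then have G_int: "(G' has_integral G T - G 0) {0..T}"
    using T by (intro fundamental_theorem_of_calculus) auto
  have arith: "v - p \<le> 2 * (A - B) - 3 * (E - B) - 3 * l"
    if "F + v / 2 = A" "F - B \<le> p" "E + l \<le> F" for A B E F l p v :: real
    using that by argo
  have "G' t \<le> (T - t) * (c - 3 * (g \<bullet> (X t - a)))" if "t \<in> {0..T}" for t
  proof -
    have "f (X t) + (Y t \<bullet> Y t) / 2 = f x"
      using hamiltonian_energy_conserved[OF f sol, of t] that by (simp add: dot_square_norm)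
    moreover have "f (X t) - f z \<le> grad f (X t) \<bullet> (X t - z)"
      using convex_on_above_gradient_plane[OF cvx f, of "X t" z] by (simp add: inner_diff_right)
    moreover have "f a + g \<bullet> (X t - a) \<le> f (X t)"
      unfolding g_def by (rule convex_on_above_gradient_plane[OF cvx f])
    ultimately have "Y t \<bullet> Y t - grad f (X t) \<bullet> (X t - z) \<le> c - 3 * (g \<bullet> (X t - a))"
      unfolding c_def by (rule arith)
    then show ?thesis
      using that unfolding G'_def by (intro mult_left_mono) auto
  qed
  with G_int bound_int have "G T - G 0 \<le> T\<^sup>2 / 2 * c"
    by (rule has_integral_le)
  moreover have "G 0 = (norm (x - z))\<^sup>2 / 2"
    by (simp add: G_def X0 Y0 dot_square_norm)
  moreover have "0 \<le> G T"
    by (simp add: G_def)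
  ultimately have "- ((norm (x - z))\<^sup>2 / T\<^sup>2) \<le> c"
    using T by (simp add: field_simps)
  then show ?thesis
    by (simp add: c_def a_def)
qed

lemma exp_minus_quarter_lower: "58 / 75 \<le> exp (- 1 / 4 :: real)"
proof -
  \<comment> \<open>\<open>n = 5\<close> is the least exponent for which \<open>(1 - 1/(4n)) ^ n\<close> exceeds \<open>58/75\<close>.\<close>
  have "58 / 75 \<le> (1 + (- 1 / 4) / real 5) ^ 5"
    by (simp add: power_divide)
  also have "\<dots> \<le> exp (- 1 / 4)"
    by (rule exp_ge_one_plus_x_over_n_power_n) auto
  finally show ?thesis .
qed

lemma flow_average_contraction:
  fixes f :: "'a::euclidean_space \<Rightarrow> real"
  assumes f: "\<And>x. f differentiable (at x)" and cvx: "convex_on UNIV f"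
    and wp: "hamiltonian_well_posed f"
    and \<alpha>: "0 < \<alpha>" and growth: "quadratic_growth \<alpha> f xmin"
  shows "f (flow_average f x (5 / (2 * sqrt \<alpha>))) - f xmin \<le> exp (- 1 / 4) * (f x - f xmin)"
proof -
  have gr: "\<alpha> / 2 * (norm (x - xmin))\<^sup>2 \<le> f x - f xmin"
    using growth unfolding quadratic_growth_def by (smt (verit))
  moreover have "0 \<le> \<alpha> / 2 * (norm (x - xmin))\<^sup>2"
    using \<alpha> by simp
  ultimately have nonneg: "0 \<le> f x - f xmin"
    by linarith
  have "(norm (x - xmin))\<^sup>2 / (5 / (2 * sqrt \<alpha>))\<^sup>2 = 8 / 25 * (\<alpha> / 2 * (norm (x - xmin))\<^sup>2)"
    using \<alpha> by (simp add: power_divide power_mult_distrib)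
  also have "\<dots> \<le> 8 / 25 * (f x - f xmin)"
    using gr by simp
  finally have "3 * (f (flow_average f x (5 / (2 * sqrt \<alpha>))) - f xmin)
      \<le> 2 * (f x - f xmin) + 8 / 25 * (f x - f xmin)"
    by (intro order_trans[OF flow_average_gap[OF f cvx wp]] add_left_mono) (use \<alpha> in simp_all)
  then have "f (flow_average f x (5 / (2 * sqrt \<alpha>))) - f xmin \<le> 58 / 75 * (f x - f xmin)"
    by (simp add: field_simps)
  also have "\<dots> \<le> exp (- 1 / 4) * (f x - f xmin)"
    using nonneg by (intro mult_right_mono exp_minus_quarter_lower)
  finally show ?thesis .
qed

theorem corollary2:
  fixes f :: "'a::euclidean_space \<Rightarrow> real"
    and xmin X0 :: 'a
    and \<alpha> \<epsilon> :: real
    and K :: nat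
    and T :: "nat \<Rightarrow> real"
  assumes "f differentiable_on UNIV"
    and "convex_on UNIV f"
    and "hamiltonian_well_posed f"
    and "unique_minimizer f xmin"
    and "\<alpha> > 0"
    and "quadratic_growth \<alpha> f xmin"
    and "\<epsilon> > 0"
    and "K > 0"
    and "int K = \<lceil>4 * ln ((f X0 - f xmin) / \<epsilon>)\<rceil>"
    and "\<forall>k\<in>{1..K}. T k = 5 / (2 * sqrt \<alpha>)"
  shows "f (HFA f 0 T X0 K) - f xmin \<le> \<epsilon> \<and>
    (\<Sum>k=1..K. T k) = 5 / (2 * sqrt \<alpha>) * real_of_int \<lceil>4 * ln ((f X0 - f xmin) / \<epsilon>)\<rceil>"
proof
  define D where "D = f X0 - f xmin"
  have f: "f differentiable (at x)" for x
    using assms(1) by (simp add: differentiable_on_def)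
  have "0 \<le> D"
    using assms(4) by (simp add: unique_minimizer_def D_def)
  \<comment> \<open>If the gap were zero, \<open>ln 0 = 0\<close> would give \<open>K = 0\<close>.\<close>
  moreover have "D \<noteq> 0"
    using assms(8,9) by (auto simp: D_def)
  ultimately have D: "0 < D"
    by simp
  have "f (HFA f 0 T X0 k) - f xmin \<le> exp (- 1 / 4) ^ k * D" if "k \<le> K" for k
    using that
  proof (induction k)
    case 0
    then show ?case by (simp add: D_def)
  next
    case (Suc k)
    have "T (Suc k) = 5 / (2 * sqrt \<alpha>)"
      using assms(10) Suc.prems by auto
    then have "f (HFA f 0 T X0 (Suc k)) - f xmin \<le> exp (- 1 / 4) * (f (HFA f 0 T X0 k) - f xmin)"
      using flow_average_contraction[OF f assms(2,3,5,6)] by simp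
    also have "\<dots> \<le> exp (- 1 / 4) * (exp (- 1 / 4) ^ k * D)"
      using Suc by (intro mult_left_mono) auto
    finally show ?case by (simp add: mult.assoc)
  qed
  then have "f (HFA f 0 T X0 K) - f xmin \<le> exp (- (real K / 4)) * D"
    by (simp flip: exp_of_nat_mult)
  also have "\<dots> \<le> exp (- ln (D / \<epsilon>)) * D"
  proof (intro mult_right_mono iffD2[OF exp_le_cancel_iff])
    have "4 * ln (D / \<epsilon>) \<le> of_int (int K)"
      unfolding assms(9) D_def by (rule le_of_int_ceiling)
    then show "- (real K / 4) \<le> - ln (D / \<epsilon>)"
      by simp
  qed (use D in simp)
  also have "\<dots> = \<epsilon>"
    using D \<open>\<epsilon> > 0\<close> by (simp add: exp_minus)
  finally show "f (HFA f 0 T X0 K) - f xmin \<le> \<epsilon>" .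
  have "(\<Sum>k=1..K. T k) = 5 / (2 * sqrt \<alpha>) * of_int (int K)"
    using assms(10) by simp
  then show "(\<Sum>k=1..K. T k) = 5 / (2 * sqrt \<alpha>) * real_of_int \<lceil>4 * ln ((f X0 - f xmin) / \<epsilon>)\<rceil>"
    by (simp only: assms(9))
qed

end
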